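(* Let $\{a_k\}_{k\ge 0}$ be a sequence of complex numbers and let $b_m=\sum_{k=0}^m\binom{m}{k}a_k$ for $m\ge 0$. Let $n\ge 1$ be an integer and let $\lambda\in\mathbb{C}\setminus\{-1,-2,\dots,-n\}$. Then $$\sum_{k=1}^n\binom{n}{k}\frac{a_k}{k+\lambda}=\begin{cases}\displaystyle\sum_{m=1}^n\frac{b_m}{m}-b_0H_n, & \text{if }\lambda=0,\\[3mm] \displaystyle\frac{1}{\lambda\binom{n+\lambda}{n}}\left[\sum_{m=1}^n\binom{\lambda-1+m}{m}b_m\right]-b_0\,\frac{1}{\lambda\binom{n+\lambda}{n}}\left[\binom{\lambda+n}{n}-1\right], & \text{if }\lambda\ne 0.\end{cases}$$
   Context: For $x\in\mathbb{C}$ and an integer $m\ge 0$, $\binom{x}{m}=\frac{x(x-1)\cdots(x-m+1)}{m!}$. $H_n=\sum_{j=1}^n\frac1j$ is the $n$-th harmonic number. *)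

theory Defs
  imports "HOL-Analysis.Analysis"
begin

end

theory Submission
  imports Defs
begin

text \<open>
  Write \<open>S n\<close> for the left-hand side. Since \<open>(n + 1 - k) * (n + 1 choose k) = (n + 1) * (n choose k)\<close>,
  the combination \<open>(n + 1 + \<lambda>) * S (n + 1) - (n + 1) * S n\<close> cancels all denominators and equals
  \<open>b (n + 1) - b 0\<close>. For \<open>\<lambda> = 0\<close> this recurrence telescopes directly; for \<open>\<lambda> \<noteq> 0\<close> it telescopes after
  multiplication by the summation factor \<open>\<lambda> * (n + \<lambda> gchoose n)\<close>.
\<close>

lemma binomial_sum_shifted_recurrence:
  fixes a :: "nat \<Rightarrow> 'a::field_char_0" and l :: 'a
  assumes nz: "\<And>k. k \<in> {1..Suc n} \<Longrightarrow> of_nat k + l \<noteq> 0"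
  shows "(of_nat (Suc n) + l) * (\<Sum>k=1..Suc n. of_nat (Suc n choose k) * (a k / (of_nat k + l)))
    = of_nat (Suc n) * (\<Sum>k=1..n. of_nat (n choose k) * (a k / (of_nat k + l)))
      + ((\<Sum>k=0..Suc n. of_nat (Suc n choose k) * a k) - a 0)"
proof -
  have term_eq: "(of_nat (Suc n) + l) * (of_nat (Suc n choose k) * (a k / (of_nat k + l)))
      = of_nat (Suc n) * (of_nat (n choose k) * (a k / (of_nat k + l))) + of_nat (Suc n choose k) * a k"
    if k: "k \<in> {1..Suc n}" for k
  proof -
    have "(Suc n - k) * (Suc n choose k) = Suc n * (n choose k)"
      using binomial_absorb_comp[of "Suc n" k] by simp
    then have "(of_nat (Suc n - k) :: 'a) * of_nat (Suc n choose k) = of_nat (Suc n) * of_nat (n choose k)"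
      by (metis of_nat_mult)
    moreover have "(of_nat (Suc n - k) :: 'a) = of_nat (Suc n) - of_nat k"
      using k by (intro of_nat_diff) auto
    ultimately have absorb: "(of_nat (Suc n) - of_nat k) * of_nat (Suc n choose k)
        = (of_nat (Suc n) * of_nat (n choose k) :: 'a)"
      by metis
    \<comment> \<open>With \<open>q\<close> for the quotient, the factor splits as (n+1) + l =
      (n+1-k) + (k+l): the first part is absorbed into \<open>n choose k\<close>, the second cancels
      the denominator and leaves \<open>a k\<close>.\<close>
    define q where "q = a k / (of_nat k + l)"
    have "a k = q * (of_nat k + l)"
      using nz[OF k] by (simp add: q_def)
    then have "(of_nat (Suc n) + l) * (of_nat (Suc n choose k) * q)
        = ((of_nat (Suc n) - of_nat k) * of_nat (Suc n choose k)) * q + of_nat (Suc n choose k) * a k"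
      by (simp only: algebra_simps)
    then show ?thesis
      unfolding absorb q_def by (simp only: mult.assoc)
  qed
  have "(of_nat (Suc n) + l) * (\<Sum>k=1..Suc n. of_nat (Suc n choose k) * (a k / (of_nat k + l)))
      = (\<Sum>k=1..Suc n. of_nat (Suc n) * (of_nat (n choose k) * (a k / (of_nat k + l)))
          + of_nat (Suc n choose k) * a k)"
    unfolding sum_distrib_left using term_eq by (intro sum.cong) auto
  also have "\<dots> = of_nat (Suc n) * (\<Sum>k=1..Suc n. of_nat (n choose k) * (a k / (of_nat k + l)))
      + (\<Sum>k=1..Suc n. of_nat (Suc n choose k) * a k)"
    by (simp only: sum.distrib sum_distrib_left)
  \<comment> \<open>The extra term at k = n+1 vanishes because \<open>n choose Suc n\<close> is
    0.\<close>
  also have "(\<Sum>k=1..Suc n. of_nat (n choose k) * (a k / (of_nat k + l)))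
      = (\<Sum>k=1..n. of_nat (n choose k) * (a k / (of_nat k + l)))"
    by simp
  also have "(\<Sum>k=1..Suc n. of_nat (Suc n choose k) * a k)
      = (\<Sum>k=0..Suc n. of_nat (Suc n choose k) * a k) - a 0"
    by (simp add: sum.atLeast_Suc_atMost[of 0])
  finally show ?thesis .
qed

text \<open>Absorption fixes the ratio of consecutive coefficients at (n+1+l)/(n+1), inverse to the
  ratio of the two factors in the recurrence for the sums; this is what makes the coefficient a
  summation factor.\<close>

lemma gbinomial_shifted_Suc:
  fixes l :: "'a::field_char_0"
  shows "of_nat (Suc n) * ((of_nat (Suc n) + l) gchoose Suc n)
    = (of_nat (Suc n) + l) * ((of_nat n + l) gchoose n)"
  using gbinomial_absorption[of n "of_nat (Suc n) + l"] by (simp add: algebra_simps)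

text \<open>The coefficient is the product of the factors (k+l)/k for k = 1, ..., n.\<close>

lemma gbinomial_shifted_nonzero:
  fixes l :: "'a::field_char_0"
  assumes "\<And>k. k \<in> {1..n} \<Longrightarrow> of_nat k + l \<noteq> 0"
  shows "((of_nat n + l) gchoose n) \<noteq> 0"
  using assms
proof (induction n)
  case (Suc n)
  then have "(of_nat (Suc n) + l) * ((of_nat n + l) gchoose n) \<noteq> 0"
    by (simp del: of_nat_Suc)
  then show ?case
    unfolding gbinomial_shifted_Suc[symmetric] by (simp del: of_nat_Suc)
qed simp

text \<open>At shift 0 the recurrence divided by n+1 has increment (b (n+1) - a 0)/(n+1); the
  subtracted parts accumulate to the harmonic number. The sort \<open>real_normed_field\<close>
  comes from \<open>harm\<close>.\<close>

lemma binomial_sum_over_index: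
  fixes a :: "nat \<Rightarrow> 'a::{field_char_0,real_normed_field}"
  shows "(\<Sum>k=1..n. of_nat (n choose k) * (a k / of_nat k))
    = (\<Sum>m=1..n. (\<Sum>k=0..m. of_nat (m choose k) * a k) / of_nat m) - a 0 * harm n"
proof (induction n)
  case (Suc n)
  have "of_nat (Suc n) * (\<Sum>k=1..Suc n. of_nat (Suc n choose k) * (a k / of_nat k))
    = of_nat (Suc n) * (\<Sum>k=1..n. of_nat (n choose k) * (a k / of_nat k))
      + ((\<Sum>k=0..Suc n. of_nat (Suc n choose k) * a k) - a 0)"
    using binomial_sum_shifted_recurrence[of n 0 a] by (simp del: of_nat_Suc sum.cl_ivl_Suc binomial_Suc_Suc)
  then have "(\<Sum>k=1..Suc n. of_nat (Suc n choose k) * (a k / of_nat k))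
    = (\<Sum>k=1..n. of_nat (n choose k) * (a k / of_nat k))
      + ((\<Sum>k=0..Suc n. of_nat (Suc n choose k) * a k) - a 0) / of_nat (Suc n)"
    by (simp del: of_nat_Suc sum.cl_ivl_Suc binomial_Suc_Suc add: field_simps)
  also have "(\<Sum>k=1..n. of_nat (n choose k) * (a k / of_nat k))
    = (\<Sum>m=1..n. (\<Sum>k=0..m. of_nat (m choose k) * a k) / of_nat m) - a 0 * harm n"
    by (rule Suc.IH)
  also have "(\<Sum>m=1..n. (\<Sum>k=0..m. of_nat (m choose k) * a k) / of_nat m) - a 0 * harm n
      + ((\<Sum>k=0..Suc n. of_nat (Suc n choose k) * a k) - a 0) / of_nat (Suc n)
    = ((\<Sum>m=1..n. (\<Sum>k=0..m. of_nat (m choose k) * a k) / of_nat m)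
      + (\<Sum>k=0..Suc n. of_nat (Suc n choose k) * a k) / of_nat (Suc n)) - a 0 * harm (Suc n)"
    unfolding harm_Suc by (simp only: diff_divide_distrib divide_inverse ring_distribs) (simp only: algebra_simps)
  also have "(\<Sum>m=1..n. (\<Sum>k=0..m. of_nat (m choose k) * a k) / of_nat m)
      + (\<Sum>k=0..Suc n. of_nat (Suc n choose k) * a k) / of_nat (Suc n)
    = (\<Sum>m=1..Suc n. (\<Sum>k=0..m. of_nat (m choose k) * a k) / of_nat m)"
    by (rule sum.nat_ivl_Suc'[symmetric, THEN trans[OF add.commute]]) simp
  finally show ?case .
qed (simp add: harm_def)

text \<open>The multiplied-out form lets the induction run without dividing by l or by the
  coefficient; at l = 0 both sides are 0.\<close>

lemma binomial_sum_over_shifted_index: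
  fixes a :: "nat \<Rightarrow> 'a::field_char_0" and l :: 'a
  assumes "\<And>k. k \<in> {1..n} \<Longrightarrow> of_nat k + l \<noteq> 0"
  shows "l * ((of_nat n + l) gchoose n) * (\<Sum>k=1..n. of_nat (n choose k) * (a k / (of_nat k + l)))
    = (\<Sum>m=1..n. ((l - 1 + of_nat m) gchoose m) * (\<Sum>k=0..m. of_nat (m choose k) * a k))
      - a 0 * (((of_nat n + l) gchoose n) - 1)"
  using assms
proof (induction n)
  case (Suc n)
  define S where "S n = (\<Sum>k=1..n. of_nat (n choose k) * (a k / (of_nat k + l)))" for n
  define B where "B m = (\<Sum>k=0..m. of_nat (m choose k) * a k)" for m
  define P where "P n = ((of_nat n + l) gchoose n)" for n
  define Q where "Q m = ((l - 1 + of_nat m) gchoose m)" for m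
  define N :: 'a where "N = of_nat (Suc n)"
  have N: "N \<noteq> 0" unfolding N_def by (simp only: of_nat_eq_0_iff)
  have rec_S: "(N + l) * S (Suc n) = N * S n + (B (Suc n) - a 0)"
    unfolding S_def B_def N_def using Suc.prems by (rule binomial_sum_shifted_recurrence)
  have rec_P: "N * P (Suc n) = (N + l) * P n"
    unfolding P_def N_def by (rule gbinomial_shifted_Suc)
  \<comment> \<open>The weights \<open>Q\<close> are the increments of \<open>P\<close>, since l - 1
    + (n+1) = n + l. Compared with \<open>rec_P\<close>, this also shows that
    \<open>Q (Suc n)\<close> is l * \<open>P n\<close> / N, the weight that the summation factor
    puts on the new term.\<close>
  have pascal: "P (Suc n) = P n + Q (Suc n)"
    using gbinomial_Suc_Suc[of "of_nat n + l" n] by (simp add: P_def Q_def algebra_simps)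
  have NQ: "N * Q (Suc n) = l * P n"
    using rec_P pascal by (simp add: algebra_simps)
  have IH: "l * P n * S n = (\<Sum>m=1..n. Q m * B m) - a 0 * (P n - 1)"
    unfolding P_def S_def Q_def B_def using Suc.prems by (intro Suc.IH) auto
  \<comment> \<open>The extra N lets \<open>rec_P\<close> move the factor N + l from
    \<open>P\<close> over to \<open>S\<close>, where \<open>rec_S\<close> applies; N is cancelled
    afterwards.\<close>
  have "N * (l * P (Suc n) * S (Suc n)) = l * P n * ((N + l) * S (Suc n))"
    using arg_cong[OF rec_P, of "\<lambda>x. l * S (Suc n) * x"] by (simp only: mult_ac)
  also have "\<dots> = N * (l * P n * S n) + (l * P n) * (B (Suc n) - a 0)"
    unfolding rec_S by (simp only: algebra_simps)
  also have "\<dots> = N * (l * P n * S n + Q (Suc n) * (B (Suc n) - a 0))"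
    unfolding NQ[symmetric] by (simp only: algebra_simps)
  finally have "l * P (Suc n) * S (Suc n) = l * P n * S n + Q (Suc n) * (B (Suc n) - a 0)"
    using N by simp
  \<comment> \<open>By \<open>pascal\<close>, subtracting \<open>Q (Suc n) * a 0\<close> raises
    \<open>P n - 1\<close> to \<open>P (Suc n) - 1\<close>.\<close>
  also have "\<dots> = (\<Sum>m=1..Suc n. Q m * B m) - a 0 * (P (Suc n) - 1)"
    unfolding IH pascal by (simp add: algebra_simps)
  finally show ?case
    unfolding P_def S_def Q_def B_def .
qed simp

theorem theorem3p1:
  fixes a b :: "nat \<Rightarrow> complex" and n :: nat and lam :: complex
  assumes b: "\<And>m. b m = (\<Sum>k=0..m. of_nat (m choose k) * a k)"
    and n: "n \<ge> 1"
    and lam: "lam \<notin> {- of_nat j | j. j \<in> {1..n}}"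
  shows "(\<Sum>k=1..n. of_nat (n choose k) * (a k / (of_nat k + lam))) =
    (if lam = 0
     then (\<Sum>m=1..n. b m / of_nat m) - b 0 * harm n
     else 1 / (lam * ((of_nat n + lam) gchoose n))
            * (\<Sum>m=1..n. ((lam - 1 + of_nat m) gchoose m) * b m)
          - b 0 * (1 / (lam * ((of_nat n + lam) gchoose n)))
            * (((lam + of_nat n) gchoose n) - 1))"
proof -
  have nz: "of_nat k + lam \<noteq> 0" if "k \<in> {1..n}" for k
    using lam that by (auto simp: add_eq_0_iff)
  have b0: "b 0 = a 0"
    by (simp add: b)
  show ?thesis
  proof (cases "lam = 0")
    case True
    then show ?thesis
      using binomial_sum_over_index[of n a] by (simp add: b0 b[symmetric])
  next
    case False
    define P where "P = ((of_nat n + lam) gchoose n)"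
    \<comment> \<open>This permits dividing the multiplied-out identity by lam *
      \<open>P\<close>.\<close>
    have "lam * P \<noteq> 0"
      using gbinomial_shifted_nonzero[of n lam] nz False by (simp add: P_def)
    moreover have "lam * P * (\<Sum>k=1..n. of_nat (n choose k) * (a k / (of_nat k + lam)))
      = (\<Sum>m=1..n. ((lam - 1 + of_nat m) gchoose m) * b m) - b 0 * (P - 1)"
      using binomial_sum_over_shifted_index[of n lam a] nz by (simp add: P_def b0 b[symmetric])
    ultimately have "(\<Sum>k=1..n. of_nat (n choose k) * (a k / (of_nat k + lam)))
      = ((\<Sum>m=1..n. ((lam - 1 + of_nat m) gchoose m) * b m) - b 0 * (P - 1)) / (lam * P)"
      by (subst nonzero_eq_divide_eq) (assumption, simp only: mult.commute[of _ "lam * P"])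
    then show ?thesis
      using False by (simp add: P_def diff_divide_distrib add.commute[of lam])
  qed
qed

end
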